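(* Let $G=(V,E)$ be a finite undirected loopless graph, $k$ a positive integer, and $f,g:V\to\mathbb{Z}$ with $f\le g$. A $k$-edge-connected and in-degree constrained orientation $D$ of $G$ is decreasingly minimal (among the $k$-edge-connected in-degree constrained orientations of $G$) if and only if there are no two nodes $s$ and $t$ for which $\varrho_D(t)\ge\varrho_D(s)+2$, $\varrho_D(t)>f(t)$, $\varrho_D(s)<g(s)$, and there are $k+1$ arc-disjoint directed paths from $s$ to $t$ in $D$.
   Context: $\varrho_D(X)$ is the number of arcs of $D$ entering $X\subseteq V$. $D$ is $k$-edge-connected if $\varrho_D(X)\ge k$ for every $\emptyset\ne X\subsetneq V$; it is in-degree constrained if $f(v)\le\varrho_D(v)\le g(v)$ for every $v\in V$. An orientation is decreasingly minimal among a family of orientations if its in-degree vector, sorted in decreasing order, is lexicographically smaller than or equal to that of every member of the family sorted likewise. *)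

theory Defs
  imports "Graph_Theory.Graph_Theory"
begin

text \<open>Parallel edges are allowed: \<open>E\<close> is a set of edge names and
  \<open>ends e\<close> is the two-element set of end-nodes of \<open>e\<close>.\<close>

locale loopless_multigraph =
  fixes V :: "'v set" and E :: "'e set" and ends :: "'e \<Rightarrow> 'v set"
  assumes finite_V: "finite V"
    and finite_E: "finite E"
    and ends_subset: "e \<in> E \<Longrightarrow> ends e \<subseteq> V"
    and card_ends: "e \<in> E \<Longrightarrow> card (ends e) = 2"

definition orientation ::
  "'v set \<Rightarrow> 'e set \<Rightarrow> ('e \<Rightarrow> 'v set) \<Rightarrow> ('v, 'e) pre_digraph \<Rightarrow> bool" where
  "orientation V E ends D \<longleftrightarrow>
     verts D = V \<and> arcs D = E \<and> (\<forall>e\<in>E. {tail D e, head D e} = ends e)"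

definition entering :: "('v, 'e) pre_digraph \<Rightarrow> 'v set \<Rightarrow> nat" where
  "entering D X = card {e \<in> arcs D. tail D e \<notin> X \<and> head D e \<in> X}"

text \<open>For a single node the library's \<open>in_degree\<close> is used; it agrees with
  \<open>entering\<close> because there are no loops.\<close>

lemma (in loopless_multigraph) entering_singleton:
  assumes "orientation V E ends D"
  shows "entering D {v} = in_degree D v"
proof -
  have "tail D e \<noteq> head D e" if "e \<in> arcs D" for e
  proof
    assume "tail D e = head D e"
    moreover have "ends e = {tail D e, head D e}" "e \<in> E"
      using assms that by (auto simp: orientation_def)
    ultimately show False
      using card_ends[of e] by simp
  qed
  then have "{e \<in> arcs D. tail D e \<notin> {v} \<and> head D e \<in> {v}} = in_arcs D v"
    unfolding in_arcs_def by (smt (verit) Collect_cong singleton_iff)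
  then show ?thesis
    by (simp add: entering_def in_degree_def)
qed

definition k_edge_connected :: "nat \<Rightarrow> ('v, 'e) pre_digraph \<Rightarrow> bool" where
  "k_edge_connected k D \<longleftrightarrow> (\<forall>X. X \<noteq> {} \<and> X \<subset> verts D \<longrightarrow> k \<le> entering D X)"

definition in_degree_constrained ::
  "('v \<Rightarrow> int) \<Rightarrow> ('v \<Rightarrow> int) \<Rightarrow> ('v, 'e) pre_digraph \<Rightarrow> bool" where
  "in_degree_constrained f g D \<longleftrightarrow>
     (\<forall>v\<in>verts D. f v \<le> int (in_degree D v) \<and> int (in_degree D v) \<le> g v)"

definition decreasing_in_degrees :: "('v, 'e) pre_digraph \<Rightarrow> nat list" where
  "decreasing_in_degrees D =
     rev (sorted_list_of_multiset (image_mset (in_degree D) (mset_set (verts D))))"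

definition decreasingly_minimal ::
  "('v, 'e) pre_digraph set \<Rightarrow> ('v, 'e) pre_digraph \<Rightarrow> bool" where
  "decreasingly_minimal F D \<longleftrightarrow> D \<in> F \<and>
     (\<forall>D'\<in>F. decreasing_in_degrees D = decreasing_in_degrees D' \<or>
             (decreasing_in_degrees D, decreasing_in_degrees D') \<in> lexord less_than)"

text \<open>The paths are indexed; for \<open>s \<noteq> t\<close> they are nonempty, so arc-disjointness
  makes them distinct.\<close>

definition arc_disjoint_paths ::
  "('v, 'e) pre_digraph \<Rightarrow> nat \<Rightarrow> 'v \<Rightarrow> 'v \<Rightarrow> bool" where
  "arc_disjoint_paths D n s t \<longleftrightarrow>
     (\<exists>P :: nat \<Rightarrow> 'e list. (\<forall>i<n. pre_digraph.apath D s (P i) t) \<and>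
        (\<forall>i<n. \<forall>j<n. i \<noteq> j \<longrightarrow> set (P i) \<inter> set (P j) = {}))"

end

theory Submission
  imports Defs
begin

text \<open>By Menger's theorem the path condition says that every set containing \<open>t\<close> but not \<open>s\<close>
  is entered by at least \<open>k + 1\<close> arcs, so reversing one path from \<open>s\<close> to \<open>t\<close> keeps the
  orientation \<open>k\<close>-edge-connected and moves one unit of in-degree from \<open>t\<close> to \<open>s\<close>. Conversely,
  uncrossing tight sets gives an exchange property of M-convex type for the in-degree vectors of
  \<open>k\<close>-edge-connected orientations, by which local minimality implies global minimality.\<close>

section \<open>Reversing arcs\<close>

definition reverse_arcs :: "'e set \<Rightarrow> ('v, 'e) pre_digraph \<Rightarrow> ('v, 'e) pre_digraph" where
  "reverse_arcs F D = D\<lparr>tail := \<lambda>e. if e \<in> F then head D e else tail D e,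
                        head := \<lambda>e. if e \<in> F then tail D e else head D e\<rparr>"

text \<open>Arcs with both ends inside or both outside \<open>X\<close> cancel, leaving the arcs of
  \<open>F\<close> that enter \<open>X\<close> minus those that leave it. A unit-capacity flow of
  value \<open>n\<close> from \<open>s\<close> to \<open>t\<close> is encoded as an arc set whose
  net value on every \<open>X\<close> is \<open>n\<close> times the indicator difference of
  \<open>t\<close> and \<open>s\<close>; singletons express conservation.\<close>

definition net_in :: "('v, 'e) pre_digraph \<Rightarrow> 'e set \<Rightarrow> 'v set \<Rightarrow> int" where
  "net_in D F X = (\<Sum>e\<in>F. of_bool (head D e \<in> X) - of_bool (tail D e \<in> X))"

lemma reverse_arcs_simps [simp]:
  "verts (reverse_arcs F D) = verts D"
  "arcs (reverse_arcs F D) = arcs D"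
  "tail (reverse_arcs F D) e = (if e \<in> F then head D e else tail D e)"
  "head (reverse_arcs F D) e = (if e \<in> F then tail D e else head D e)"
  by (simp_all add: reverse_arcs_def)

lemma fin_digraph_reverse_arcs:
  assumes "fin_digraph D"
  shows "fin_digraph (reverse_arcs F D)"
proof -
  interpret fin_digraph D by fact
  show ?thesis by unfold_locales auto
qed

lemma entering_eq_sum:
  assumes "finite (arcs D)"
  shows "int (entering D X) = (\<Sum>e\<in>arcs D. of_bool (tail D e \<notin> X \<and> head D e \<in> X))"
  unfolding entering_def using assms
  by (simp add: sum.If_cases of_bool_def Int_def)

lemma entering_reverse_arcs:
  assumes "finite (arcs D)" "F \<subseteq> arcs D"
  shows "int (entering (reverse_arcs F D) X) = int (entering D X) - net_in D F X"
proof -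
  have "net_in D F X = (\<Sum>e\<in>arcs D. if e \<in> F then of_bool (head D e \<in> X) - of_bool (tail D e \<in> X) else 0)"
    unfolding net_in_def using assms by (simp add: sum.inter_restrict[symmetric] Int_absorb1)
  moreover have "finite (arcs (reverse_arcs F D))"
    using assms by simp
  ultimately show ?thesis
    unfolding entering_eq_sum[OF \<open>finite (arcs (reverse_arcs F D))\<close>] entering_eq_sum[OF assms(1)]
    by (simp only: sum_subtractf[symmetric] reverse_arcs_simps) (rule sum.cong; auto)
qed

text \<open>The difference of the two sides counts the arcs entering \<open>X\<close> after
  reversing \<open>F\<close>, so it is nonnegative.\<close>

lemma net_in_le_entering:
  assumes "finite (arcs D)" "F \<subseteq> arcs D"
  shows "net_in D F X \<le> int (entering D X)"
  using entering_reverse_arcs[OF assms, of X] by linarith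

lemma net_in_Diff:
  assumes "finite F" "P \<subseteq> F"
  shows "net_in D (F - P) X = net_in D F X - net_in D P X"
  unfolding net_in_def using assms by (simp add: sum_diff)

text \<open>Augmentation in the residual graph: an arc of \<open>P\<close> lying in \<open>F\<close>
  is traversed backwards, so its contribution changes sign and cancels the one in \<open>F\<close>;
  the other arcs of \<open>P\<close> are simply added.\<close>

lemma net_in_sym_diff:
  fixes D :: "('v, 'e) pre_digraph"
  assumes "finite F" "finite P"
  shows "net_in D ((F - P) \<union> (P - F)) X = net_in D F X + net_in (reverse_arcs F D) P X"
proof -
  define h :: "'e \<Rightarrow> int" where "h e = of_bool (head D e \<in> X) - of_bool (tail D e \<in> X)" for e
  have "net_in (reverse_arcs F D) P X = (\<Sum>e\<in>P. if e \<in> F then - h e else h e)"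
    unfolding net_in_def h_def by (rule sum.cong) auto
  also have "\<dots> = sum h (P - F) - sum h (P \<inter> F)"
    using assms by (simp add: sum.If_cases sum_negf Diff_eq)
  finally have rev: "net_in (reverse_arcs F D) P X = sum h (P - F) - sum h (P \<inter> F)" .
  have "sum h ((F - P) \<union> (P - F)) = sum h (F - P) + sum h (P - F)"
    using assms by (intro sum.union_disjoint) auto
  moreover have "sum h F = sum h (F - P) + sum h (P \<inter> F)"
    using assms by (metis Diff_disjoint Int_Diff_Un Int_commute add.commute finite_Diff finite_Int
        sum.Int_Diff)
  ultimately show ?thesis
    unfolding rev by (simp add: net_in_def h_def[abs_def])
qed

text \<open>Consecutive arcs share a node, so the indicators at all inner nodes cancel.\<close>

lemma cas_sum_list_telescope:
  assumes "pre_digraph.cas D s p t"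
  shows "(\<Sum>e\<leftarrow>p. of_bool (head D e \<in> X) - of_bool (tail D e \<in> X) :: int)
         = of_bool (t \<in> X) - of_bool (s \<in> X)"
  using assms
proof (induction p arbitrary: s)
  case Nil
  then show ?case by (simp add: pre_digraph.cas.simps)
next
  case (Cons e p)
  then have "tail D e = s" "pre_digraph.cas D (head D e) p t"
    by (simp_all add: pre_digraph.cas.simps)
  then show ?case
    using Cons.IH[of "head D e"] by simp
qed

lemma (in wf_digraph) net_in_apath:
  assumes "apath s p t"
  shows "net_in G (set p) X = of_bool (t \<in> X) - of_bool (s \<in> X)"
proof -
  have "distinct p" "cas s p t"
    using assms distinct_verts_imp_distinct by (auto simp: apath_def awalk_def)
  then show ?thesis
    using cas_sum_list_telescope[of G s p t X] by (simp add: net_in_def sum_list_distinct_conv_sum_set)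
qed

section \<open>Cuts and arc-disjoint paths\<close>

text \<open>The one-path case of Menger's theorem: no arc enters the set of nodes unreachable from
  \<open>s\<close>, since a reachable tail makes the head reachable.\<close>

lemma (in wf_digraph) apath_if_cuts_entered:
  assumes "s \<in> verts G" "t \<in> verts G"
    and cuts: "\<And>X. X \<subseteq> verts G \<Longrightarrow> t \<in> X \<Longrightarrow> s \<notin> X \<Longrightarrow> entering G X > 0"
  obtains p where "apath s p t"
proof -
  have "s \<rightarrow>\<^sup>* t"
  proof (rule ccontr)
    assume "\<not> s \<rightarrow>\<^sup>* t"
    let ?X = "{v \<in> verts G. \<not> s \<rightarrow>\<^sup>* v}"
    have "entering G ?X > 0"
      using assms \<open>\<not> s \<rightarrow>\<^sup>* t\<close> by (intro cuts) auto
    then obtain e where e: "e \<in> arcs G" "tail G e \<notin> ?X" "head G e \<in> ?X"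
      unfolding entering_def by (metis (mono_tags, lifting) Collect_empty_eq card.empty less_irrefl)
    then have "s \<rightarrow>\<^sup>* tail G e" by simp
    moreover have "tail G e \<rightarrow> head G e"
      using e(1) by (rule in_arcs_imp_in_arcs_ends)
    ultimately have "s \<rightarrow>\<^sup>* head G e"
      by (rule reachable_adj_trans)
    with e(3) show False by simp
  qed
  then show thesis
    using that reachable_apath by blast
qed

text \<open>The flow is built by repeatedly reversing a path; the reversed graph is the residual graph.\<close>

lemma (in fin_digraph) flow_if_cuts_large:
  assumes "s \<in> verts G" "t \<in> verts G"
    and "\<And>X. X \<subseteq> verts G \<Longrightarrow> t \<in> X \<Longrightarrow> s \<notin> X \<Longrightarrow> entering G X \<ge> n"
  shows "\<exists>F \<subseteq> arcs G. \<forall>X. net_in G F X = int n * (of_bool (t \<in> X) - of_bool (s \<in> X))"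
  using assms(3)
proof (induction n)
  case 0
  show ?case by (rule exI[of _ "{}"]) (simp add: net_in_def)
next
  case (Suc n)
  then have "\<And>X. X \<subseteq> verts G \<Longrightarrow> t \<in> X \<Longrightarrow> s \<notin> X \<Longrightarrow> entering G X \<ge> n"
    using Suc_leD by blast
  then obtain F where F: "F \<subseteq> arcs G"
    "\<And>X. net_in G F X = int n * (of_bool (t \<in> X) - of_bool (s \<in> X))"
    using Suc.IH by metis
  let ?H = "reverse_arcs F G"
  interpret H: fin_digraph ?H
    by (rule fin_digraph_reverse_arcs) (rule fin_digraph_axioms)
  \<comment> \<open>Reversing a flow of value \<open>n\<close> lowers each of these cuts by exactly
    \<open>n\<close>, so at least one of the original \<open>Suc n\<close> entering arcs is
    left.\<close>
  have "entering ?H X > 0" if "X \<subseteq> verts ?H" "t \<in> X" "s \<notin> X" for X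
    using entering_reverse_arcs[OF finite_arcs F(1), of X] F(2)[of X] Suc.prems[of X] that by simp
  then obtain p where p: "H.apath s p t"
    using H.apath_if_cuts_entered[of s t] assms(1,2) by auto
  let ?F = "(F - set p) \<union> (set p - F)"
  have "set p \<subseteq> arcs G"
    using p by (auto simp: H.apath_def H.awalk_def)
  moreover have "finite F"
    using F(1) finite_arcs finite_subset by blast
  then have "net_in G ?F X = int (Suc n) * (of_bool (t \<in> X) - of_bool (s \<in> X))" for X
    using F(2)[of X] H.net_in_apath[OF p, of X] by (simp add: net_in_sym_diff algebra_simps)
  ultimately show ?case
    using F(1) by (intro exI[of _ ?F]) blast
qed

lemma cas_arcs_update:
  "pre_digraph.cas (D\<lparr>arcs := F\<rparr>) u p v \<longleftrightarrow> pre_digraph.cas D u p v"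
  by (induction p arbitrary: u) (simp_all add: pre_digraph.cas.simps)

lemma awalk_verts_arcs_update:
  "pre_digraph.awalk_verts (D\<lparr>arcs := F\<rparr>) u p = pre_digraph.awalk_verts D u p"
  by (induction p arbitrary: u) (simp_all add: pre_digraph.awalk_verts.simps)

text \<open>Lets paths be sought inside the support of a flow: the walk structure depends only on
  \<open>tail\<close> and \<open>head\<close>, so restricting the arcs merely adds a membership
  condition.\<close>

lemma apath_arcs_update:
  assumes "F \<subseteq> arcs D"
  shows "pre_digraph.apath (D\<lparr>arcs := F\<rparr>) u p v \<longleftrightarrow> pre_digraph.apath D u p v \<and> set p \<subseteq> F"
  using assms unfolding pre_digraph.apath_def pre_digraph.awalk_def
  by (auto simp: cas_arcs_update awalk_verts_arcs_update)

text \<open>Flow decomposition: positive net flow forces an arc of \<open>F\<close> into every cut,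
  so \<open>F\<close> contains a path from \<open>s\<close> to \<open>t\<close>, and deleting its
  arcs lowers the flow value by one. Confining all paths to \<open>F\<close> makes later ones
  disjoint from it.\<close>

lemma (in fin_digraph) arc_disjoint_paths_in_flow:
  assumes "s \<in> verts G" "t \<in> verts G" "F \<subseteq> arcs G"
    and "\<And>X. net_in G F X = int n * (of_bool (t \<in> X) - of_bool (s \<in> X))"
  shows "\<exists>P. (\<forall>i<n. apath s (P i) t \<and> set (P i) \<subseteq> F) \<and>
           (\<forall>i<n. \<forall>j<n. i \<noteq> j \<longrightarrow> set (P i) \<inter> set (P j) = {})"
  using assms(3,4)
proof (induction n arbitrary: F)
  case 0
  then show ?case by simp
next
  case (Suc n)
  let ?H = "G\<lparr>arcs := F\<rparr>"
  have "finite F"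
    using Suc.prems(1) finite_arcs finite_subset by blast
  have "fin_digraph ?H"
    using Suc.prems(1) \<open>finite F\<close> by unfold_locales auto
  then interpret H: fin_digraph ?H .
  have "entering ?H X > 0" if "X \<subseteq> verts ?H" "t \<in> X" "s \<notin> X" for X
    using net_in_le_entering[of ?H F X] Suc.prems(2)[of X] \<open>finite F\<close> that by (simp add: net_in_def)
  then obtain p where "H.apath s p t"
    using H.apath_if_cuts_entered[of s t] assms(1,2) by auto
  then have p: "apath s p t" "set p \<subseteq> F"
    using apath_arcs_update[OF Suc.prems(1)] by auto
  have "net_in G (F - set p) X = int n * (of_bool (t \<in> X) - of_bool (s \<in> X))" for X
    using net_in_Diff[OF \<open>finite F\<close> p(2), of G X] net_in_apath[OF p(1), of X] Suc.prems(2)[of X]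
    by (simp add: algebra_simps)
  then obtain P where P: "\<And>i. i < n \<Longrightarrow> apath s (P i) t \<and> set (P i) \<subseteq> F - set p"
    "\<And>i j. i < n \<Longrightarrow> j < n \<Longrightarrow> i \<noteq> j \<Longrightarrow> set (P i) \<inter> set (P j) = {}"
    using Suc.IH[of "F - set p"] Suc.prems(1) by (metis Diff_subset order_trans)
  let ?P = "P(n := p)"
  have "apath s (?P i) t \<and> set (?P i) \<subseteq> F" if "i < Suc n" for i
    using that P(1)[of i] p by (cases "i = n") auto
  moreover have "set (?P i) \<inter> set (?P j) = {}" if "i < Suc n" "j < Suc n" "i \<noteq> j" for i j
    using that P(1)[of i] P(1)[of j] P(2)[of i j] by (cases "i = n"; cases "j = n") auto
  ultimately show ?case by blast
qed

theorem (in fin_digraph) Menger_arc_disjoint: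
  assumes "s \<in> verts G" "t \<in> verts G"
  shows "arc_disjoint_paths G n s t \<longleftrightarrow>
    (\<forall>X \<subseteq> verts G. t \<in> X \<longrightarrow> s \<notin> X \<longrightarrow> n \<le> entering G X)"
proof
  assume "arc_disjoint_paths G n s t"
  then obtain P where P: "\<And>i. i < n \<Longrightarrow> apath s (P i) t"
    "\<And>i j. i < n \<Longrightarrow> j < n \<Longrightarrow> i \<noteq> j \<Longrightarrow> set (P i) \<inter> set (P j) = {}"
    unfolding arc_disjoint_paths_def by blast
  let ?F = "\<Union>i<n. set (P i)"
  have sub: "?F \<subseteq> arcs G"
    using P(1) by (auto simp: apath_def awalk_def)
  \<comment> \<open>Disjointness makes the net values add up, so the union of the paths is a flow of
    value \<open>n\<close>, which bounds every cut from below.\<close>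
  have "net_in G ?F X = (\<Sum>i<n. net_in G (set (P i)) X)" for X
    unfolding net_in_def using P(2) by (intro sum.UNION_disjoint) auto
  moreover have "(\<Sum>i<n. net_in G (set (P i)) X)
      = (\<Sum>i<n. of_bool (t \<in> X) - of_bool (s \<in> X))" for X
    using P(1) by (intro sum.cong refl net_in_apath) simp
  ultimately have net: "net_in G ?F X = int n * (of_bool (t \<in> X) - of_bool (s \<in> X))" for X
    by simp
  show "\<forall>X \<subseteq> verts G. t \<in> X \<longrightarrow> s \<notin> X \<longrightarrow> n \<le> entering G X"
  proof (intro allI impI)
    fix X assume "t \<in> X" "s \<notin> X"
    then show "n \<le> entering G X"
      using net[of X] net_in_le_entering[OF finite_arcs sub, of X] by simp
  qed
next
  assume "\<forall>X \<subseteq> verts G. t \<in> X \<longrightarrow> s \<notin> X \<longrightarrow> n \<le> entering G X"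
  then obtain F where "F \<subseteq> arcs G"
    "\<And>X. net_in G F X = int n * (of_bool (t \<in> X) - of_bool (s \<in> X))"
    using flow_if_cuts_large[OF assms, of n] by metis
  then show "arc_disjoint_paths G n s t"
    using arc_disjoint_paths_in_flow[OF assms, of F n] unfolding arc_disjoint_paths_def by blast
qed

text \<open>Compared arc by arc: an arc entering the intersection or the union enters
  \<open>X\<close> or \<open>Y\<close>, and an arc entering both of them enters both
  \<open>X\<close> and \<open>Y\<close>.\<close>

lemma entering_submodular:
  assumes "finite (arcs D)"
  shows "entering D (X \<inter> Y) + entering D (X \<union> Y) \<le> entering D X + entering D Y"
proof -
  have "int (entering D (X \<inter> Y)) + int (entering D (X \<union> Y))
      \<le> int (entering D X) + int (entering D Y)"
    unfolding entering_eq_sum[OF assms] sum.distrib[symmetric] by (rule sum_mono) auto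
  then show ?thesis by linarith
qed

section \<open>Exchange between orientations\<close>

context loopless_multigraph
begin

lemma fin_digraph_orientation:
  assumes "orientation V E ends D"
  shows "fin_digraph D"
proof
  fix e assume "e \<in> arcs D"
  then show "tail D e \<in> verts D" "head D e \<in> verts D"
    using assms ends_subset unfolding orientation_def by blast+
qed (use assms finite_V finite_E in \<open>auto simp: orientation_def\<close>)

lemma orientation_reverse_arcs:
  assumes "orientation V E ends D"
  shows "orientation V E ends (reverse_arcs F D)"
  using assms by (auto simp: orientation_def insert_commute)

text \<open>An arc with head in \<open>X\<close> either enters \<open>X\<close> or lies inside it.
  The second count is the same for all orientations, so comparing in-degree sums over
  \<open>X\<close> amounts to comparing cuts.\<close>

lemma sum_in_degree:
  assumes "orientation V E ends D" "X \<subseteq> V"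
  shows "(\<Sum>v\<in>X. in_degree D v) = entering D X + card {e \<in> E. ends e \<subseteq> X}"
proof -
  have arcs: "arcs D = E" and ends: "\<And>e. e \<in> E \<Longrightarrow> ends e = {tail D e, head D e}"
    using assms(1) by (auto simp: orientation_def)
  have "finite X"
    using assms(2) finite_V finite_subset by blast
  have "(\<Sum>v\<in>X. in_degree D v) = card (\<Union>v\<in>X. in_arcs D v)"
    unfolding in_degree_def using \<open>finite X\<close> finite_E
    by (intro card_UN_disjoint[symmetric]) (auto simp: in_arcs_def arcs)
  also have "(\<Union>v\<in>X. in_arcs D v)
      = {e \<in> arcs D. tail D e \<notin> X \<and> head D e \<in> X} \<union> {e \<in> E. ends e \<subseteq> X}"
    using ends by (auto simp: in_arcs_def arcs)
  also have "card \<dots> = entering D X + card {e \<in> E. ends e \<subseteq> X}"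
    unfolding entering_def using ends finite_E by (intro card_Un_disjoint) (auto simp: arcs)
  finally show ?thesis .
qed

lemma sum_in_degree_V:
  assumes "orientation V E ends D"
  shows "(\<Sum>v\<in>V. in_degree D v) = card E"
proof -
  interpret fin_digraph D by (rule fin_digraph_orientation[OF assms])
  have "{e \<in> arcs D. tail D e \<notin> V \<and> head D e \<in> V} = {}"
    using assms tail_in_verts by (auto simp: orientation_def)
  then have "entering D V = 0"
    by (simp add: entering_def)
  moreover have "{e \<in> E. ends e \<subseteq> V} = E"
    using ends_subset by blast
  ultimately show ?thesis
    using sum_in_degree[OF assms, of V] by simp
qed

text \<open>If every candidate \<open>v\<close> were separated from \<open>u\<close> by a tight set, the complements of the
  minimal tight sets around \<open>u\<close> would be disjoint and cover all nodes whose in-degree is larger in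
  \<open>D'\<close>. The in-degree sum of each complement is maximal in \<open>D\<close>, so \<open>D'\<close> would have fewer arcs.\<close>

lemma exchange_node:
  assumes D: "orientation V E ends D" "k_edge_connected k D"
    and D': "orientation V E ends D'" "k_edge_connected k D'"
    and u: "u \<in> V" "in_degree D' u < in_degree D u"
  shows "\<exists>v\<in>V. in_degree D v < in_degree D' v \<and>
           (\<forall>X\<subseteq>V. u \<in> X \<longrightarrow> v \<notin> X \<longrightarrow> k + 1 \<le> entering D X)"
proof (rule ccontr)
  assume contra: "\<not> ?thesis"
  interpret fin_digraph D by (rule fin_digraph_orientation[OF D(1)])
  have verts: "verts D = V" "verts D' = V"
    using D(1) D'(1) by (auto simp: orientation_def)
  define d where "d v = int (in_degree D' v) - int (in_degree D v)" for v
  define \<T> where "\<T> = {X. X \<subset> V \<and> u \<in> X \<and> entering D X = k}"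
  define \<M> where "\<M> = {X \<in> \<T>. \<forall>Y\<in>\<T>. Y \<subseteq> X \<longrightarrow> Y = X}"
  have "finite \<T>"
    by (rule finite_subset[of _ "Pow V"]) (auto simp: \<T>_def finite_V)
  then have "finite \<M>"
    by (simp add: \<M>_def)
  have large: "k \<le> entering D X" "k \<le> entering D' X" if "X \<subset> V" "X \<noteq> {}" for X
    using D(2) D'(2) that verts by (auto simp: k_edge_connected_def)
  have cover: "\<exists>X\<in>\<M>. v \<notin> X" if v: "v \<in> V" "d v > 0" for v
  proof -
    obtain X where X: "X \<subseteq> V" "u \<in> X" "v \<notin> X" "\<not> k + 1 \<le> entering D X"
      using contra v unfolding d_def by (metis of_nat_less_iff diff_gt_0_iff_gt)
    moreover have "X \<subset> V"
      using X v by blast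
    moreover have "k \<le> entering D X"
      using \<open>X \<subset> V\<close> X(2) by (intro large(1)) auto
    ultimately have "X \<in> \<T>"
      by (simp add: \<T>_def)
    then obtain Y where "Y \<in> \<T>" "Y \<subseteq> X" "\<forall>Z\<in>\<T>. Z \<subseteq> Y \<longrightarrow> Y = Z"
      using finite_has_minimal2[OF \<open>finite \<T>\<close>] by metis
    then show ?thesis
      using X(3) by (auto simp: \<M>_def)
  qed
  have disjoint: "(V - X) \<inter> (V - Y) = {}" if "X \<in> \<M>" "Y \<in> \<M>" "X \<noteq> Y" for X Y
  proof (rule ccontr)
    assume ne: "(V - X) \<inter> (V - Y) \<noteq> {}"
    have XY: "X \<in> \<T>" "Y \<in> \<T>"
      using that by (auto simp: \<M>_def)
    \<comment> \<open>Uncrossing: both sets contain \<open>u\<close> and miss a common node, so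
      their intersection and union are nonempty and proper. Submodularity then makes the
      intersection tight, against minimality.\<close>
    have "X \<union> Y \<subset> V" "X \<inter> Y \<subset> V" "u \<in> X \<inter> Y"
      using XY ne by (auto simp: \<T>_def)
    moreover from calculation have "k \<le> entering D (X \<union> Y)" "k \<le> entering D (X \<inter> Y)"
      by (intro large(1); blast)+
    then have "entering D (X \<inter> Y) = k"
      using entering_submodular[OF finite_arcs, of X Y] XY by (simp add: \<T>_def)
    ultimately have "X \<inter> Y \<in> \<T>"
      by (simp add: \<T>_def)
    then have "X \<inter> Y = X" "X \<inter> Y = Y"
      using that unfolding \<M>_def by blast+
    with \<open>X \<noteq> Y\<close> show False by blast
  qed
  have "(\<Sum>v\<in>V. d v) = 0"
    using arg_cong[OF sum_in_degree_V[OF D(1)], of int] arg_cong[OF sum_in_degree_V[OF D'(1)], of int]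
    by (simp add: d_def sum_subtractf)
  have compl: "(\<Sum>v\<in>V - X. d v) \<le> 0" if "X \<in> \<M>" for X
  proof -
    have X: "X \<subset> V" "X \<noteq> {}" "entering D X = k"
      using that by (auto simp: \<M>_def \<T>_def)
    \<comment> \<open>A tight set has the least possible in-degree sum in \<open>D\<close>. As the
      totals over \<open>V\<close> agree, \<open>D'\<close> can only lose on the complement.\<close>
    then have "(\<Sum>v\<in>X. in_degree D v) \<le> (\<Sum>v\<in>X. in_degree D' v)"
      using sum_in_degree[OF D(1), of X] sum_in_degree[OF D'(1), of X] large(2)[of X] by auto
    then have "(\<Sum>v\<in>X. d v) \<ge> 0"
      by (simp add: d_def sum_subtractf flip: of_nat_sum)
    moreover have "(\<Sum>v\<in>V. d v) = (\<Sum>v\<in>V - X. d v) + (\<Sum>v\<in>X. d v)"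
      using X(1) by (intro sum.subset_diff) (auto simp: finite_V)
    ultimately show ?thesis
      using \<open>(\<Sum>v\<in>V. d v) = 0\<close> by linarith
  qed
  let ?C = "\<Union>X\<in>\<M>. V - X"
  have "(\<Sum>v\<in>?C. d v) = (\<Sum>X\<in>\<M>. \<Sum>v\<in>V - X. d v)"
    using \<open>finite \<M>\<close> disjoint finite_V by (intro sum.UNION_disjoint) auto
  also have "\<dots> \<le> 0"
    using compl by (rule sum_nonpos)
  finally have "(\<Sum>v\<in>?C. d v) \<le> 0" .
  moreover have "(\<Sum>v\<in>V - ?C. d v) < (\<Sum>v\<in>V - ?C. 0)"
  proof (rule sum_strict_mono_ex1)
    show "\<forall>v\<in>V - ?C. d v \<le> 0"
    proof
      fix v assume "v \<in> V - ?C"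
      then have "v \<in> V" "\<not> (\<exists>X\<in>\<M>. v \<notin> X)" by auto
      then show "d v \<le> 0"
        using cover[of v] by linarith
    qed
    \<comment> \<open>Every tight set under consideration contains \<open>u\<close>, so no
      complement covers it; it supplies the strict inequality.\<close>
    have "u \<in> V - ?C" "d u < 0"
      using u by (auto simp: \<M>_def \<T>_def d_def)
    then show "\<exists>v\<in>V - ?C. d v < 0" by blast
  qed (simp add: finite_V)
  moreover have "(\<Sum>v\<in>V. d v) = (\<Sum>v\<in>V - ?C. d v) + (\<Sum>v\<in>?C. d v)"
    by (intro sum.subset_diff) (auto simp: finite_V)
  ultimately show False
    using \<open>(\<Sum>v\<in>V. d v) = 0\<close> by simp
qed

lemma shift_in_degree:
  assumes D: "orientation V E ends D" "k_edge_connected k D"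
    and st: "s \<in> V" "t \<in> V"
    and cuts: "\<And>X. X \<subseteq> V \<Longrightarrow> t \<in> X \<Longrightarrow> s \<notin> X \<Longrightarrow> k + 1 \<le> entering D X"
  obtains D' where "orientation V E ends D'" "k_edge_connected k D'"
    "\<And>v. int (in_degree D' v) = int (in_degree D v) - of_bool (v = t) + of_bool (v = s)"
proof -
  interpret fin_digraph D by (rule fin_digraph_orientation[OF D(1)])
  have verts: "verts D = V"
    using D(1) by (auto simp: orientation_def)
  obtain p where p: "apath s p t"
  proof (rule apath_if_cuts_entered)
    show "s \<in> verts D" "t \<in> verts D"
      using st verts by auto
    show "entering D X > 0" if "X \<subseteq> verts D" "t \<in> X" "s \<notin> X" for X
      using cuts[of X] that verts by simp
  qed
  let ?D' = "reverse_arcs (set p) D"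
  have "set p \<subseteq> arcs D"
    using p by (auto simp: apath_def awalk_def)
  then have ent: "int (entering ?D' X) = int (entering D X) - of_bool (t \<in> X) + of_bool (s \<in> X)" for X
    by (simp add: entering_reverse_arcs net_in_apath[OF p])
  have ori: "orientation V E ends ?D'"
    by (rule orientation_reverse_arcs[OF D(1)])
  have "k \<le> entering ?D' X" if X: "X \<noteq> {}" "X \<subset> V" for X
  proof -
    have "k \<le> entering D X"
      using D(2) X verts by (auto simp: k_edge_connected_def)
    then show ?thesis
      using ent[of X] cuts[of X] X by (cases "t \<in> X"; cases "s \<in> X") auto
  qed
  then have "k_edge_connected k ?D'"
    by (simp add: k_edge_connected_def verts)
  moreover have "int (in_degree ?D' v) = int (in_degree D v) - of_bool (v = t) + of_bool (v = s)" for v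
    using ent[of "{v}"] entering_singleton[OF D(1), of v] entering_singleton[OF ori, of v] by auto
  ultimately show thesis
    using that ori by blast
qed

end

section \<open>Decreasing order of in-degrees\<close>

lemma sorted_list_of_multiset_add_max:
  assumes "\<And>x. x \<in># M \<Longrightarrow> x \<le> y"
  shows "sorted_list_of_multiset (add_mset y M) = sorted_list_of_multiset M @ [y]"
proof -
  have "sorted (sorted_list_of_multiset M @ [y])"
    using assms by (simp add: sorted_append)
  then have "sorted_list_of_multiset (mset (sorted_list_of_multiset M @ [y]))
      = sorted_list_of_multiset M @ [y]"
    by (simp only: sorted_list_of_multiset_mset sorted_sort_id)
  then show ?thesis by simp
qed

text \<open>Here \<open>x\<close> is the largest value whose multiplicities differ. Equal maxima are
  stripped from both multisets until the maxima differ, and then that of \<open>N\<close> is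
  smaller.\<close>

lemma rev_sorted_lexord:
  fixes M N :: "nat multiset"
  assumes "size M = size N" "count N x < count M x" "\<And>y. y > x \<Longrightarrow> count M y = count N y"
  shows "(rev (sorted_list_of_multiset N), rev (sorted_list_of_multiset M)) \<in> lexord less_than"
  using assms
proof (induction "size M" arbitrary: M N)
  case 0
  then show ?case by simp
next
  case (Suc n)
  have "M \<noteq> {#}" "N \<noteq> {#}"
    using Suc.hyps(2) Suc.prems(1) by auto
  define y z where "y = Max_mset M" and "z = Max_mset N"
  have yz: "y \<in># M" "z \<in># N" "\<And>a. a \<in># M \<Longrightarrow> a \<le> y" "\<And>a. a \<in># N \<Longrightarrow> a \<le> z"
    using \<open>M \<noteq> {#}\<close> \<open>N \<noteq> {#}\<close> by (auto simp: y_def z_def)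
  define M' N' where "M' = M - {#y#}" and "N' = N - {#z#}"
  have MN: "M = add_mset y M'" "N = add_mset z N'"
    using yz by (auto simp: M'_def N'_def)
  have list: "rev (sorted_list_of_multiset M) = y # rev (sorted_list_of_multiset M')"
    "rev (sorted_list_of_multiset N) = z # rev (sorted_list_of_multiset N')"
    using yz(3,4) unfolding MN by (subst sorted_list_of_multiset_add_max; simp)+
  have "x \<in># M"
    using Suc.prems(2) by (metis count_inI not_less_zero)
  then have "x \<le> y"
    by (rule yz(3))
  \<comment> \<open>A maximum of \<open>N\<close> above \<open>y\<close> would exceed
    \<open>x\<close>, where the multiplicities agree, and so would occur in
    \<open>M\<close>.\<close>
  have "z \<le> y"
  proof (rule ccontr)
    assume "\<not> z \<le> y"
    then have "count M z = count N z" "z \<notin># M"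
      using \<open>x \<le> y\<close> Suc.prems(3)[of z] yz(3)[of z] by auto
    then show False
      using yz(2) by (metis not_in_iff)
  qed
  show ?case
  proof (cases "z = y")
    case True
    have "(rev (sorted_list_of_multiset N'), rev (sorted_list_of_multiset M')) \<in> lexord less_than"
    proof (rule Suc.hyps(1))
      show "n = size M'" "size M' = size N'"
        using Suc.hyps(2) Suc.prems(1) by (simp_all add: MN)
      show "count N' x < count M' x"
        using Suc.prems(2) by (simp add: MN True split: if_splits)
      show "count M' w = count N' w" if "x < w" for w
        using Suc.prems(3)[OF that] by (simp add: MN True split: if_splits)
    qed
    then show ?thesis
      by (simp add: list True)
  next
    case False
    then show ?thesis
      using \<open>z \<le> y\<close> by (simp add: list)
  qed
qed

text \<open>Only the values at \<open>s\<close> and \<open>t\<close> change. With a gap of at least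
  2, the old value at \<open>t\<close> loses an occurrence and both new values lie below it; with a
  gap of 1 the two values are swapped.\<close>

lemma decreasing_in_degrees_shift:
  fixes D D' :: "('v, 'e) pre_digraph"
  assumes "finite (verts D)" "verts D' = verts D" "s \<in> verts D" "t \<in> verts D"
    and deg: "\<And>v. int (in_degree D' v) = int (in_degree D v) - of_bool (v = t) + of_bool (v = s)"
  shows "in_degree D t \<ge> in_degree D s + 2 \<Longrightarrow>
      (decreasing_in_degrees D', decreasing_in_degrees D) \<in> lexord less_than"
    and "in_degree D t = in_degree D s + 1 \<Longrightarrow>
      decreasing_in_degrees D' = decreasing_in_degrees D"
proof -
  define K where "K = image_mset (in_degree D) (mset_set (verts D - {t} - {s}))"
  have K: "image_mset (in_degree D') (mset_set (verts D - {t} - {s})) = K"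
    unfolding K_def
  proof (rule image_mset_cong)
    fix v assume "v \<in># mset_set (verts D - {t} - {s})"
    then have "v \<noteq> s" "v \<noteq> t"
      using assms(1) by auto
    then show "in_degree D' v = in_degree D v"
      using deg[of v] by simp
  qed
  have split: "mset_set (verts D) = add_mset t (add_mset s (mset_set (verts D - {t} - {s})))"
    if "s \<noteq> t"
    using mset_set.remove[of "verts D" t] mset_set.remove[of "verts D - {t}" s] assms(1,3,4) that
    by simp
  have ms: "image_mset (in_degree D) (mset_set (verts D)) = K + {#in_degree D s, in_degree D t#}"
    "image_mset (in_degree D') (mset_set (verts D')) = K + {#in_degree D s + 1, in_degree D t - 1#}"
    if "in_degree D s < in_degree D t"
  proof -
    have "s \<noteq> t"
      using that by auto
    have "in_degree D' s = in_degree D s + 1" "in_degree D' t = in_degree D t - 1"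
      using deg[of s] deg[of t] \<open>s \<noteq> t\<close> that by auto
    then show "image_mset (in_degree D) (mset_set (verts D)) = K + {#in_degree D s, in_degree D t#}"
      "image_mset (in_degree D') (mset_set (verts D')) = K + {#in_degree D s + 1, in_degree D t - 1#}"
      unfolding assms(2) split[OF \<open>s \<noteq> t\<close>] image_mset_add_mset K by (simp_all add: K_def)
  qed
  show "(decreasing_in_degrees D', decreasing_in_degrees D) \<in> lexord less_than"
    if "in_degree D t \<ge> in_degree D s + 2"
  proof -
    have lt: "in_degree D s < in_degree D t"
      using that by simp
    show ?thesis
      unfolding decreasing_in_degrees_def ms[OF lt]
      by (rule rev_sorted_lexord[where x = "in_degree D t"]) (use that in auto)
  qed
  show "decreasing_in_degrees D' = decreasing_in_degrees D"
    if "in_degree D t = in_degree D s + 1"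
  proof -
    have lt: "in_degree D s < in_degree D t"
      using that by simp
    have "{#in_degree D s + 1, in_degree D t - 1#} = {#in_degree D s, in_degree D t#}"
      by (simp add: that add_mset_commute)
    then show ?thesis
      unfolding decreasing_in_degrees_def ms[OF lt] by (simp only:)
  qed
qed

section \<open>Local optimality implies global optimality\<close>

context loopless_multigraph
begin

text \<open>Among the nodes where \<open>D\<close> and \<open>D'\<close> differ, take the largest in-degree value occurring in
  either. By the exchange property and local optimality of \<open>D\<close> it occurs in \<open>D'\<close>; lowering it
  there moves \<open>D'\<close> towards \<open>D\<close> without making it worse.\<close>

lemma locally_minimal_imp_not_greater:
  assumes D: "orientation V E ends D" "k_edge_connected k D" "in_degree_constrained f g D"
    and D': "orientation V E ends D'" "k_edge_connected k D'" "in_degree_constrained f g D'"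
    and local: "\<And>s t. s \<in> V \<Longrightarrow> t \<in> V \<Longrightarrow> in_degree D t \<ge> in_degree D s + 2 \<Longrightarrow>
      int (in_degree D t) > f t \<Longrightarrow> int (in_degree D s) < g s \<Longrightarrow>
      \<exists>X\<subseteq>V. t \<in> X \<and> s \<notin> X \<and> \<not> k + 1 \<le> entering D X"
  shows "(decreasing_in_degrees D', decreasing_in_degrees D) \<notin> lexord less_than"
  using D'
proof (induction "\<Sum>v\<in>V. nat \<bar>int (in_degree D v) - int (in_degree D' v)\<bar>"
    arbitrary: D' rule: less_induct)
  case less
  note D' = less.prems
  have verts: "verts D = V" "verts D' = V"
    using D(1) D'(1) by (auto simp: orientation_def)
  have irrefl: "(xs, xs) \<notin> lexord less_than" for xs
    by (simp add: lexord_irreflexive)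
  define W where "W = {v \<in> V. in_degree D v \<noteq> in_degree D' v}"
  show ?case
  proof (cases "W = {}")
    case True
    then have "image_mset (in_degree D) (mset_set V) = image_mset (in_degree D') (mset_set V)"
      using finite_V by (intro image_mset_cong) (auto simp: W_def)
    then have "decreasing_in_degrees D = decreasing_in_degrees D'"
      by (simp add: decreasing_in_degrees_def verts)
    then show ?thesis
      using irrefl by simp
  next
    case False
    define \<beta> where "\<beta> = Max ((\<lambda>v. max (in_degree D v) (in_degree D' v)) ` W)"
    have "finite W"
      using finite_V by (simp add: W_def)
    have \<beta>: "in_degree D v \<le> \<beta>" "in_degree D' v \<le> \<beta>" if "v \<in> W" for v
      using Max_ge[OF finite_imageI[OF \<open>finite W\<close>] imageI[OF that],
          of "\<lambda>v. max (in_degree D v) (in_degree D' v)"]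
      by (auto simp: \<beta>_def)
    have "\<beta> \<in> (\<lambda>v. max (in_degree D v) (in_degree D' v)) ` W"
      unfolding \<beta>_def using \<open>finite W\<close> False by (intro Max_in) auto
    then obtain w where w: "w \<in> W" "\<beta> = max (in_degree D w) (in_degree D' w)" by blast
    obtain v where v: "v \<in> V" "in_degree D' v = \<beta>" "in_degree D v < \<beta>"
    proof (cases "in_degree D' w = \<beta>")
      case True
      then show thesis
        using that[of w] w by (auto simp: W_def max_def split: if_splits)
    next
      case False
      then have wD: "w \<in> V" "in_degree D w = \<beta>" "in_degree D' w < in_degree D w"
        using w by (auto simp: W_def max_def split: if_splits)
      obtain x where x: "x \<in> V" "in_degree D x < in_degree D' x"
        "\<forall>X\<subseteq>V. w \<in> X \<longrightarrow> x \<notin> X \<longrightarrow> k + 1 \<le> entering D X"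
        using exchange_node[OF D(1,2) D'(1,2) wD(1,3)] by blast
      have "f w \<le> int (in_degree D' w)" "int (in_degree D' x) \<le> g x"
        using D'(3) wD(1) x(1) by (auto simp: in_degree_constrained_def verts)
      then have "int (in_degree D w) > f w" "int (in_degree D x) < g x"
        using wD(3) x(2) by linarith+
      \<comment> \<open>Local optimality rules out a gap of 2, so the in-degree of \<open>x\<close>
        is at least \<open>\<beta> - 1\<close> in \<open>D\<close> and larger in \<open>D'\<close>;
        maximality of \<open>\<beta>\<close> makes the latter equal to
        \<open>\<beta>\<close>.\<close>
      then have "\<not> in_degree D w \<ge> in_degree D x + 2"
        using local[of x w] x wD(1) by blast
      moreover have "in_degree D' x \<le> \<beta>"
        using \<beta>(2)[of x] x(1,2) by (auto simp: W_def)
      ultimately show thesis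
        using that[of x] x wD(2) by linarith
    qed
    obtain x where x: "x \<in> V" "in_degree D' x < in_degree D x"
      "\<forall>X\<subseteq>V. v \<in> X \<longrightarrow> x \<notin> X \<longrightarrow> k + 1 \<le> entering D' X"
      using exchange_node[OF D'(1,2) D(1,2) v(1)] v by blast
    obtain D'' where D'': "orientation V E ends D''" "k_edge_connected k D''"
      and deg: "\<And>z. int (in_degree D'' z)
        = int (in_degree D' z) - of_bool (z = v) + of_bool (z = x)"
    proof (rule shift_in_degree[OF D'(1,2) x(1) v(1)])
      show "k + 1 \<le> entering D' X" if "X \<subseteq> V" "v \<in> X" "x \<notin> X" for X
        using x(3) that by blast
    qed (rule that)
    have "x \<noteq> v"
      using v x(1,2) by auto
    have verts'': "verts D'' = V"
      using D''(1) by (auto simp: orientation_def)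
    have bounds: "f z \<le> int (in_degree D z)" "int (in_degree D z) \<le> g z"
      "f z \<le> int (in_degree D' z)" "int (in_degree D' z) \<le> g z" if "z \<in> V" for z
      using D(3) D'(3) that by (auto simp: in_degree_constrained_def verts)
    \<comment> \<open>The changed values at \<open>v\<close> and \<open>x\<close> move towards those
      of \<open>D\<close> without passing them, so the bounds persist.\<close>
    have "f z \<le> int (in_degree D'' z) \<and> int (in_degree D'' z) \<le> g z" if "z \<in> V" for z
      using bounds[OF that] deg[of z] v x(1,2) by (cases "z = v"; cases "z = x") auto
    then have constr: "in_degree_constrained f g D''"
      by (simp add: in_degree_constrained_def verts'')
    have closer: "(\<Sum>v\<in>V. nat \<bar>int (in_degree D v) - int (in_degree D'' v)\<bar>)
        < (\<Sum>v\<in>V. nat \<bar>int (in_degree D v) - int (in_degree D' v)\<bar>)"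
    proof (rule sum_strict_mono_ex1[OF finite_V])
      show "\<forall>z\<in>V. nat \<bar>int (in_degree D z) - int (in_degree D'' z)\<bar>
          \<le> nat \<bar>int (in_degree D z) - int (in_degree D' z)\<bar>"
      proof
        fix z
        show "nat \<bar>int (in_degree D z) - int (in_degree D'' z)\<bar>
          \<le> nat \<bar>int (in_degree D z) - int (in_degree D' z)\<bar>"
          using deg[of z] v x(1,2) by (cases "z = v"; cases "z = x") auto
      qed
      show "\<exists>z\<in>V. nat \<bar>int (in_degree D z) - int (in_degree D'' z)\<bar>
          < nat \<bar>int (in_degree D z) - int (in_degree D' z)\<bar>"
        using deg[of v] v \<open>x \<noteq> v\<close> by (intro bexI[of _ v]) auto
    qed
    have "(decreasing_in_degrees D'', decreasing_in_degrees D) \<notin> lexord less_than"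
      using less.hyps[OF closer D'' constr] .
    moreover have "decreasing_in_degrees D'' = decreasing_in_degrees D' \<or>
        (decreasing_in_degrees D'', decreasing_in_degrees D') \<in> lexord less_than"
    proof -
      \<comment> \<open>The choice of \<open>\<beta>\<close> enters here: \<open>x\<close> has
        in-degree below \<open>\<beta>\<close> in \<open>D'\<close>, so the shift from
        \<open>v\<close> to \<open>x\<close> crosses a gap of at least 1 and never worsens
        \<open>D'\<close>.\<close>
      have "in_degree D x \<le> \<beta>"
        using \<beta>(1)[of x] x(1,2) by (auto simp: W_def)
      then have "in_degree D' v = in_degree D' x + 1 \<or> in_degree D' v \<ge> in_degree D' x + 2"
        using v(2) x(2) by linarith
      then show ?thesis
        using decreasing_in_degrees_shift[of D' D'' x v, OF _ _ _ _ deg] finite_V verts verts'' x(1) v(1)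
        by auto
    qed
    ultimately show ?thesis
      using lexord_trans[OF _ _ trans_less_than] by metis
  qed
qed

end

theorem theorem10p8:
  fixes V :: "'v set" and E :: "'e set" and ends :: "'e \<Rightarrow> 'v set"
    and k :: nat and f g :: "'v \<Rightarrow> int" and D :: "('v, 'e) pre_digraph"
  assumes "loopless_multigraph V E ends"
    and "k > 0"
    and "\<forall>v\<in>V. f v \<le> g v"
    and "orientation V E ends D"
    and "k_edge_connected k D"
    and "in_degree_constrained f g D"
  shows "decreasingly_minimal
           {D'. orientation V E ends D' \<and> k_edge_connected k D' \<and> in_degree_constrained f g D'} D
         \<longleftrightarrow> \<not> (\<exists>s\<in>V. \<exists>t\<in>V. in_degree D t \<ge> in_degree D s + 2 \<and>
                 int (in_degree D t) > f t \<and> int (in_degree D s) < g s \<and>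
                 arc_disjoint_paths D (k + 1) s t)"
    (is "decreasingly_minimal ?F D \<longleftrightarrow> \<not> ?improvable")
proof -
  interpret loopless_multigraph V E ends by fact
  interpret fin_digraph D
    by (rule fin_digraph_orientation[OF assms(4)])
  have verts: "verts D = V"
    using assms(4) by (auto simp: orientation_def)
  note D = assms(4-6)
  show ?thesis
  proof
    assume min: "decreasingly_minimal ?F D"
    show "\<not> ?improvable"
    proof
      assume ?improvable
      then obtain s t where st: "s \<in> V" "t \<in> V" "in_degree D t \<ge> in_degree D s + 2"
        "int (in_degree D t) > f t" "int (in_degree D s) < g s"
        "arc_disjoint_paths D (k + 1) s t" by blast
      have cuts: "\<forall>X\<subseteq>V. t \<in> X \<longrightarrow> s \<notin> X \<longrightarrow> k + 1 \<le> entering D X"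
        using Menger_arc_disjoint[of s t "k + 1"] st verts by simp
      obtain D' where D': "orientation V E ends D'" "k_edge_connected k D'"
        and deg: "\<And>v. int (in_degree D' v)
          = int (in_degree D v) - of_bool (v = t) + of_bool (v = s)"
      proof (rule shift_in_degree[OF D(1,2) st(1,2)])
        show "k + 1 \<le> entering D X" if "X \<subseteq> V" "t \<in> X" "s \<notin> X" for X
          using cuts that by blast
      qed (rule that)
      have verts': "verts D' = V"
        using D'(1) by (auto simp: orientation_def)
      \<comment> \<open>The strict inequalities at \<open>t\<close> and \<open>s\<close> leave room
        for one unit each.\<close>
      have "f v \<le> int (in_degree D' v) \<and> int (in_degree D' v) \<le> g v" if "v \<in> V" for v
      proof -
        have "f v \<le> int (in_degree D v)" "int (in_degree D v) \<le> g v"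
          using D(3) that by (auto simp: in_degree_constrained_def verts)
        then show ?thesis
          using deg[of v] st by (cases "v = s"; cases "v = t") auto
      qed
      then have "D' \<in> ?F"
        using D' by (simp add: in_degree_constrained_def verts')
      then have "decreasing_in_degrees D = decreasing_in_degrees D' \<or>
          (decreasing_in_degrees D, decreasing_in_degrees D') \<in> lexord less_than"
        using min by (auto simp: decreasingly_minimal_def)
      moreover have "(decreasing_in_degrees D', decreasing_in_degrees D) \<in> lexord less_than"
        using decreasing_in_degrees_shift(1)[of D D' s t, OF _ _ _ _ deg] finite_V verts verts' st
        by auto
      ultimately have "(decreasing_in_degrees D, decreasing_in_degrees D) \<in> lexord less_than"
        using lexord_trans[OF _ _ trans_less_than] by metis
      then show False
        using lexord_irreflexive[of less_than "decreasing_in_degrees D"] by simp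
    qed
  next
    assume opt: "\<not> ?improvable"
    have "(decreasing_in_degrees D', decreasing_in_degrees D) \<notin> lexord less_than" if "D' \<in> ?F" for D'
    proof (rule locally_minimal_imp_not_greater[OF D])
      show "orientation V E ends D'" "k_edge_connected k D'" "in_degree_constrained f g D'"
        using that by auto
      show "\<exists>X\<subseteq>V. t \<in> X \<and> s \<notin> X \<and> \<not> k + 1 \<le> entering D X"
        if "s \<in> V" "t \<in> V" "in_degree D t \<ge> in_degree D s + 2"
          "int (in_degree D t) > f t" "int (in_degree D s) < g s" for s t
        using opt that Menger_arc_disjoint[of s t "k + 1"] verts by blast
    qed
    \<comment> \<open>Linearity of the order turns "no member is smaller" into "smaller than or
      equal to every member".\<close>
    moreover have "(xs, ys) \<in> lexord less_than \<or> xs = ys \<or> (ys, xs) \<in> lexord less_than"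
      for xs ys :: "nat list"
      by (rule lexord_linear) auto
    ultimately show "decreasingly_minimal ?F D"
      unfolding decreasingly_minimal_def using D by blast
  qed
qed

end
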